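(* (The Shadow Lemma) Let $\Gamma \subset \mathsf{Homeo}(M)$ be a non-elementary convergence group, let $\sigma \colon \Gamma \times M \rightarrow \mathbb{R}$ be an expanding coarse-cocycle, and let $\mu$ be a coarse $\sigma$-Patterson--Sullivan measure of dimension $\beta$. For any sufficiently small $\epsilon>0$ there exists $C=C(\epsilon) >1$ such that $$\frac{1}{C} e^{-\beta \|\gamma\|_{\sigma}} \leq \mu\left( \mathcal{S}_\epsilon(\gamma) \right) \leq C e^{-\beta \|\gamma\|_{\sigma}}$$ for all $\gamma \in \Gamma$.
   Context: Convergence groups. $M$ is a compact metrizable space. A subgroup $\Gamma\subset\mathsf{Homeo}(M)$ is a (discrete) convergence group if for every sequence $\{\gamma_n\}$ of distinct elements of $\Gamma$ there are $x,y\in M$ and a subsequence $\{\gamma_{n_j}\}$ such that $\gamma_{n_j}|_{M\smallsetminus\{y\}}$ converges locally uniformly to the constant $x$. The limit set $\Lambda(\Gamma)$ is the set of $x\in M$ for which there are $y\in M$ and a sequence $\{\gamma_n\}\subset\Gamma$ with $\gamma_n|_{M\smallsetminus\{y\}}\to x$ locally uniformly. $\Gamma$ is non-elementary if $\#\Lambda(\Gamma)\ge 3$. An element $\gamma$ is loxodromic if it has two fixed points $\gamma^+\ne\gamma^-$ in $\Lambda(\Gamma)$ such that $\gamma^{\pm n}|_{M\smallsetminus\{\gamma^{\mp}\}}$ converges locally uniformly to $\gamma^{\pm}$ as $n\to+\infty$. Compatible metrics. $\Gamma\sqcup M$ carries a unique compact metrizable topology for which the inclusions of $\Gamma$ (discrete)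 and of $M$ are embeddings and the natural action of $\Gamma$ (left multiplication on $\Gamma$) is a convergence group action. A compatible metric $\mathrm{d}$ is a metric on $\Gamma\sqcup M$ inducing this topology; fix one. Shadows: for $\epsilon>0$ and $\gamma\in\Gamma$, $\mathcal{S}_\epsilon(\gamma):=\gamma\left(M\smallsetminus B_\epsilon(\gamma^{-1})\right)$, where $B_\epsilon(\gamma^{-1})\subset\Gamma\sqcup M$ is the open $\mathrm{d}$-ball of radius $\epsilon$ centered at the point $\gamma^{-1}$. Coarse-cocycles. For $\kappa\ge0$, $\sigma\colon\Gamma\times M\to\mathbb{R}$ is a $\kappa$-coarse-cocycle if (i) $\limsup_{x\to x_0}|\sigma(\gamma,x_0)-\sigma(\gamma,x)|\le\kappa$ for all $\gamma\in\Gamma$, $x_0\in M$, and (ii) $|\sigma(\gamma_1\gamma_2,x)-(\sigma(\gamma_1,\gamma_2x)+\sigma(\gamma_2,x))|\le\kappa$ for all $\gamma_1,\gamma_2\in\Gamma$, $x\in M$. A coarse-cocycle is a $\kappa$-coarse-cocycle for some $\kappa$. It is proper if $\sigma(\gamma_n,\gamma_n^+)\to+\infty$ whenever $\{\gamma_n\}\subset\Gamma$ is a sequence of distinct loxodromic elements with $\liminf_n\mathrm{d}(\gamma_n^-,\gamma_n^+)>0$. It is expanding if it is proper and for each $\gamma\in\Gamma$ there is a number $\|\gamma\|_\sigma\in\mathbb{R}$ (the $\sigma$-magnitude) such that for every $\epsilon>0$ there is $C>0$ with $\|\gamma\|_\sigma-C\le\sigma(\gamma,x)\le\|\gamma\|_\sigma+C$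 whenever $x\in M$, $\gamma\in\Gamma$ and $\mathrm{d}(x,\gamma^{-1})>\epsilon$. The magnitude function is any fixed choice; two choices differ by a bounded amount. Patterson--Sullivan measures: a Borel probability measure $\mu$ on $M$ is a $C$-coarse $\sigma$-Patterson--Sullivan measure of dimension $\beta$ if for every $\gamma\in\Gamma$ the measures $\mu$ and $\gamma_*\mu$ are mutually absolutely continuous and $e^{-C-\beta\sigma(\gamma^{-1},\cdot)}\le\frac{d\gamma_*\mu}{d\mu}\le e^{C-\beta\sigma(\gamma^{-1},\cdot)}$ $\mu$-almost everywhere; it is coarse if this holds for some $C$. *)

theory Defs
  imports "HOL-Algebra.Group" "HOL-Probability.Probability"
begin

text \<open>In this theory \<open>inv \<gamma>\<close> is always the inverse function of HOL.\<close>
unbundle no m_inv_syntax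


section \<open>Groups of homeomorphisms\<close>

definition Homeo :: "('m::topological_space \<Rightarrow> 'm) monoid" where
  "Homeo = \<lparr>carrier = {f. homeomorphic_map euclidean euclidean f}, monoid.mult = (\<circ>), one = id\<rparr>"

lemma homeomorphic_map_inv:
  assumes "homeomorphic_map euclidean euclidean (f :: 'm::topological_space \<Rightarrow> 'm)"
  shows "homeomorphic_map euclidean euclidean (inv f)" "f \<circ> inv f = id" "inv f \<circ> f = id"
proof -
  from assms obtain g where g: "homeomorphic_maps euclidean euclidean f g"
    by (auto simp: homeomorphic_map_maps)
  then have "f (g x) = x" "g (f x) = x" for x
    by (auto simp: homeomorphic_maps_def)
  then have fg: "f \<circ> g = id" "g \<circ> f = id" by (auto simp: fun_eq_iff)
  then have eq: "inv f = g" by (metis inv_unique_comp)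
  show "homeomorphic_map euclidean euclidean (inv f)"
    using g eq homeomorphic_maps_map by metis
  show "f \<circ> inv f = id" "inv f \<circ> f = id" using fg eq by auto
qed

lemma group_Homeo: "group (Homeo :: ('m::topological_space \<Rightarrow> 'm) monoid)"
proof (rule groupI, goal_cases)
  case 1 then show ?case by (auto simp: Homeo_def intro: homeomorphic_map_compose)
next
  case 2 then show ?case by (simp add: Homeo_def)
next
  case 3 then show ?case by (simp add: Homeo_def o_assoc)
next
  case 4 then show ?case by (simp add: Homeo_def)
next
  case (5 f)
  then show ?case
    using homeomorphic_map_inv[of f] by (auto simp: Homeo_def)
qed

lemma m_inv_Homeo: "f \<in> carrier Homeo \<Longrightarrow> m_inv Homeo f = inv f"
  using homeomorphic_map_inv[of f]
  by (intro group.inv_equality[OF group_Homeo]) (auto simp: Homeo_def)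


section \<open>Convergence groups\<close>

text \<open>Locally uniform convergence on \<open>S \<subseteq> topspace X\<close> to the constant \<open>x\<close>: every point of \<open>S\<close> has
  a neighbourhood in \<open>S\<close> on which the convergence is uniform.  As the limit is a constant,
  uniformity only involves the neighbourhoods of \<open>x\<close>, and no metric has to be chosen;
  the lemma after the definition gives the formulation with any metric inducing the topology.\<close>

definition loc_unif_conv_const ::
  "'a topology \<Rightarrow> 'a set \<Rightarrow> (nat \<Rightarrow> 'a \<Rightarrow> 'a) \<Rightarrow> 'a \<Rightarrow> bool" where
  "loc_unif_conv_const X S f x \<longleftrightarrow>
     (\<forall>z\<in>S. \<exists>V. openin (subtopology X S) V \<and> z \<in> V \<and>
        (\<forall>U. openin X U \<and> x \<in> U \<longrightarrow> (\<forall>\<^sub>F n in sequentially. \<forall>v\<in>V. f n v \<in> U)))"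

lemma (in Metric_space) loc_unif_conv_const_metric:
  assumes "x \<in> M" "S \<subseteq> M" "\<And>n v. v \<in> M \<Longrightarrow> f n v \<in> M"
  shows "loc_unif_conv_const mtopology S f x \<longleftrightarrow>
     (\<forall>z\<in>S. \<exists>V. openin (subtopology mtopology S) V \<and> z \<in> V \<and>
        (\<forall>e>0. \<forall>\<^sub>F n in sequentially. \<forall>v\<in>V. d x (f n v) < e))"
proof -
  have "(\<forall>U. openin mtopology U \<and> x \<in> U \<longrightarrow> (\<forall>\<^sub>F n in sequentially. \<forall>v\<in>V. f n v \<in> U)) \<longleftrightarrow>
        (\<forall>e>0. \<forall>\<^sub>F n in sequentially. \<forall>v\<in>V. d x (f n v) < e)" (is "?L \<longleftrightarrow> ?R")
    if V: "openin (subtopology mtopology S) V" for V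
  proof
    assume L: ?L
    show ?R
    proof (intro allI impI)
      fix e :: real assume "e > 0"
      then have "\<forall>\<^sub>F n in sequentially. \<forall>v\<in>V. f n v \<in> mball x e"
        using L[rule_format, of "mball x e"] openin_mball assms(1) by (simp only: centre_in_mball_iff)
      then show "\<forall>\<^sub>F n in sequentially. \<forall>v\<in>V. d x (f n v) < e"
        by (rule eventually_mono) auto
    qed
  next
    assume R: ?R
    have VM: "V \<subseteq> M" using V assms(2) openin_subset by fastforce
    show ?L
    proof (intro allI impI)
      fix U assume "openin mtopology U \<and> x \<in> U"
      then obtain e where e: "e > 0" "mball x e \<subseteq> U"
        by (auto simp: openin_mtopology)
      have "\<forall>\<^sub>F n in sequentially. \<forall>v\<in>V. d x (f n v) < e" using R e by blast
      then show "\<forall>\<^sub>F n in sequentially. \<forall>v\<in>V. f n v \<in> U"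
      proof (rule eventually_mono, intro ballI)
        fix n v assume "\<forall>v\<in>V. d x (f n v) < e" "v \<in> V"
        then have "f n v \<in> mball x e" using VM assms by auto
        then show "f n v \<in> U" using e by blast
      qed
    qed
  qed
  then show ?thesis unfolding loc_unif_conv_const_def by (simp cong: conj_cong)
qed

text \<open>\<open>\<rho>\<close> is an action of the set of group elements \<open>G\<close> on the space \<open>X\<close>.\<close>

definition convergence_action :: "'a topology \<Rightarrow> 'g set \<Rightarrow> ('g \<Rightarrow> 'a \<Rightarrow> 'a) \<Rightarrow> bool" where
  "convergence_action X G \<rho> \<longleftrightarrow>
     (\<forall>g\<in>G. homeomorphic_map X X (\<rho> g)) \<and>
     (\<forall>\<gamma> :: nat \<Rightarrow> 'g. inj \<gamma> \<and> range \<gamma> \<subseteq> G \<longrightarrow>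
        (\<exists>x\<in>topspace X. \<exists>y\<in>topspace X. \<exists>r :: nat \<Rightarrow> nat. strict_mono r \<and>
           loc_unif_conv_const X (topspace X - {y}) (\<lambda>j. \<rho> (\<gamma> (r j))) x))"

definition convergence_group :: "('m::topological_space \<Rightarrow> 'm) set \<Rightarrow> bool" where
  "convergence_group \<Gamma> \<longleftrightarrow>
     subgroup \<Gamma> Homeo \<and> convergence_action euclidean \<Gamma> (\<lambda>\<gamma>. \<gamma>)"

definition limit_set :: "('m::topological_space \<Rightarrow> 'm) set \<Rightarrow> 'm set" where
  "limit_set \<Gamma> = {x. \<exists>y. \<exists>\<gamma> :: nat \<Rightarrow> 'm \<Rightarrow> 'm.
     range \<gamma> \<subseteq> \<Gamma> \<and> loc_unif_conv_const euclidean (UNIV - {y}) \<gamma> x}"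

definition non_elementary :: "('m::topological_space \<Rightarrow> 'm) set \<Rightarrow> bool" where
  "non_elementary \<Gamma> \<longleftrightarrow> infinite (limit_set \<Gamma>) \<or> card (limit_set \<Gamma>) \<ge> 3"

text \<open>\<open>\<gamma>\<close> is a loxodromic element of \<open>\<Gamma>\<close> with \<open>\<gamma>\<^sup>+ = p\<close> and \<open>\<gamma>\<^sup>- = q\<close>.\<close>

definition loxodromic_with ::
  "('m::topological_space \<Rightarrow> 'm) set \<Rightarrow> ('m \<Rightarrow> 'm) \<Rightarrow> 'm \<Rightarrow> 'm \<Rightarrow> bool" where
  "loxodromic_with \<Gamma> \<gamma> p q \<longleftrightarrow>
     \<gamma> \<in> \<Gamma> \<and> p \<in> limit_set \<Gamma> \<and> q \<in> limit_set \<Gamma> \<and> p \<noteq> q \<and> \<gamma> p = p \<and> \<gamma> q = q \<and>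
     loc_unif_conv_const euclidean (UNIV - {q}) (\<lambda>n. \<gamma> ^^ n) p \<and>
     loc_unif_conv_const euclidean (UNIV - {p}) (\<lambda>n. inv \<gamma> ^^ n) q"


section \<open>Compatible metrics and shadows\<close>

text \<open>The disjoint union of \<open>\<Gamma>\<close> and \<open>M\<close> is the set \<open>\<Gamma> <+> UNIV\<close> in the type
  \<open>('m \<Rightarrow> 'm) + 'm\<close>; there \<open>Inl\<close> and \<open>Inr\<close> are the inclusions of \<open>\<Gamma>\<close> and \<open>M\<close>.\<close>

definition compatible_metric ::
  "('m::topological_space \<Rightarrow> 'm) set \<Rightarrow> (('m \<Rightarrow> 'm) + 'm \<Rightarrow> ('m \<Rightarrow> 'm) + 'm \<Rightarrow> real) \<Rightarrow> bool" where
  "compatible_metric \<Gamma> d \<longleftrightarrow>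
     Metric_space (\<Gamma> <+> UNIV) d \<and>
     (let T = Metric_space.mtopology (\<Gamma> <+> UNIV) d in
        compact_space T \<and>
        embedding_map (discrete_topology \<Gamma>) T Inl \<and>
        embedding_map euclidean T Inr \<and>
        convergence_action T \<Gamma> (\<lambda>\<gamma>. map_sum (\<lambda>g. \<gamma> \<circ> g) \<gamma>))"

definition shadow ::
  "('m \<Rightarrow> 'm) set \<Rightarrow> (('m \<Rightarrow> 'm) + 'm \<Rightarrow> ('m \<Rightarrow> 'm) + 'm \<Rightarrow> real) \<Rightarrow>
     real \<Rightarrow> ('m \<Rightarrow> 'm) \<Rightarrow> 'm set" where
  "shadow \<Gamma> d \<epsilon> \<gamma> =
     \<gamma> ` {x. Inr x \<notin> Metric_space.mball (\<Gamma> <+> UNIV) d (Inl (inv \<gamma>)) \<epsilon>}"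


section \<open>Coarse-cocycles\<close>

definition kcoarse_cocycle ::
  "('m::topological_space \<Rightarrow> 'm) set \<Rightarrow> real \<Rightarrow> (('m \<Rightarrow> 'm) \<Rightarrow> 'm \<Rightarrow> real) \<Rightarrow> bool" where
  "kcoarse_cocycle \<Gamma> \<kappa> \<sigma> \<longleftrightarrow>
     (\<forall>\<gamma>\<in>\<Gamma>. \<forall>x\<^sub>0. Limsup (at x\<^sub>0) (\<lambda>x. ereal \<bar>\<sigma> \<gamma> x\<^sub>0 - \<sigma> \<gamma> x\<bar>) \<le> ereal \<kappa>) \<and>
     (\<forall>\<gamma>\<^sub>1\<in>\<Gamma>. \<forall>\<gamma>\<^sub>2\<in>\<Gamma>. \<forall>x. \<bar>\<sigma> (\<gamma>\<^sub>1 \<circ> \<gamma>\<^sub>2) x - (\<sigma> \<gamma>\<^sub>1 (\<gamma>\<^sub>2 x) + \<sigma> \<gamma>\<^sub>2 x)\<bar> \<le> \<kappa>)"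

definition coarse_cocycle ::
  "('m::topological_space \<Rightarrow> 'm) set \<Rightarrow> (('m \<Rightarrow> 'm) \<Rightarrow> 'm \<Rightarrow> real) \<Rightarrow> bool" where
  "coarse_cocycle \<Gamma> \<sigma> \<longleftrightarrow> (\<exists>\<kappa>\<ge>0. kcoarse_cocycle \<Gamma> \<kappa> \<sigma>)"

definition proper_cocycle ::
  "('m::topological_space \<Rightarrow> 'm) set \<Rightarrow> (('m \<Rightarrow> 'm) + 'm \<Rightarrow> ('m \<Rightarrow> 'm) + 'm \<Rightarrow> real) \<Rightarrow>
     (('m \<Rightarrow> 'm) \<Rightarrow> 'm \<Rightarrow> real) \<Rightarrow> bool" where
  "proper_cocycle \<Gamma> d \<sigma> \<longleftrightarrow>
     (\<forall>(\<gamma> :: nat \<Rightarrow> 'm \<Rightarrow> 'm) p q.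
        inj \<gamma> \<and> (\<forall>n. loxodromic_with \<Gamma> (\<gamma> n) (p n) (q n)) \<and>
        liminf (\<lambda>n. ereal (d (Inr (q n)) (Inr (p n)))) > 0
        \<longrightarrow> filterlim (\<lambda>n. \<sigma> (\<gamma> n) (p n)) at_top sequentially)"

text \<open>\<open>N\<close> is a choice of magnitude function; the constant \<open>C\<close> depends on \<open>\<epsilon>\<close>, not on \<open>\<gamma>\<close>.\<close>

definition magnitude ::
  "('m \<Rightarrow> 'm) set \<Rightarrow> (('m \<Rightarrow> 'm) + 'm \<Rightarrow> ('m \<Rightarrow> 'm) + 'm \<Rightarrow> real) \<Rightarrow>
     (('m \<Rightarrow> 'm) \<Rightarrow> 'm \<Rightarrow> real) \<Rightarrow> (('m \<Rightarrow> 'm) \<Rightarrow> real) \<Rightarrow> bool" where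
  "magnitude \<Gamma> d \<sigma> N \<longleftrightarrow>
     (\<forall>\<epsilon>>0. \<exists>C>0. \<forall>x. \<forall>\<gamma>\<in>\<Gamma>. d (Inr x) (Inl (inv \<gamma>)) > \<epsilon> \<longrightarrow>
        N \<gamma> - C \<le> \<sigma> \<gamma> x \<and> \<sigma> \<gamma> x \<le> N \<gamma> + C)"

definition expanding_coarse_cocycle ::
  "('m::topological_space \<Rightarrow> 'm) set \<Rightarrow> (('m \<Rightarrow> 'm) + 'm \<Rightarrow> ('m \<Rightarrow> 'm) + 'm \<Rightarrow> real) \<Rightarrow>
     (('m \<Rightarrow> 'm) \<Rightarrow> 'm \<Rightarrow> real) \<Rightarrow> bool" where
  "expanding_coarse_cocycle \<Gamma> d \<sigma> \<longleftrightarrow>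
     coarse_cocycle \<Gamma> \<sigma> \<and> proper_cocycle \<Gamma> d \<sigma> \<and> (\<exists>N. magnitude \<Gamma> d \<sigma> N)"


section \<open>Patterson--Sullivan measures\<close>

definition C_coarse_PS_measure ::
  "('m::topological_space \<Rightarrow> 'm) set \<Rightarrow> (('m \<Rightarrow> 'm) \<Rightarrow> 'm \<Rightarrow> real) \<Rightarrow>
     real \<Rightarrow> real \<Rightarrow> 'm measure \<Rightarrow> bool" where
  "C_coarse_PS_measure \<Gamma> \<sigma> C \<beta> \<mu> \<longleftrightarrow>
     sets \<mu> = sets borel \<and> prob_space \<mu> \<and>
     (\<forall>\<gamma>\<in>\<Gamma>.
        absolutely_continuous \<mu> (distr \<mu> borel \<gamma>) \<and>
        absolutely_continuous (distr \<mu> borel \<gamma>) \<mu> \<and>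
        (AE x in \<mu>.
           ennreal (exp (- C - \<beta> * \<sigma> (inv \<gamma>) x)) \<le> RN_deriv \<mu> (distr \<mu> borel \<gamma>) x \<and>
           RN_deriv \<mu> (distr \<mu> borel \<gamma>) x \<le> ennreal (exp (C - \<beta> * \<sigma> (inv \<gamma>) x))))"

definition coarse_PS_measure ::
  "('m::topological_space \<Rightarrow> 'm) set \<Rightarrow> (('m \<Rightarrow> 'm) \<Rightarrow> 'm \<Rightarrow> real) \<Rightarrow> real \<Rightarrow> 'm measure \<Rightarrow> bool"
  where "coarse_PS_measure \<Gamma> \<sigma> \<beta> \<mu> \<longleftrightarrow> (\<exists>C. C_coarse_PS_measure \<Gamma> \<sigma> C \<beta> \<mu>)"

end

(* The shadow is the image under \<gamma> of the complement of the \<epsilon>-ball around inv \<gamma>, where \<sigma> \<gamma> equals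
   N \<gamma> up to a constant.  Integrating the density of the pushforward of \<mu> under inv \<gamma> over that
   complement shows that the measure of the shadow is comparable to exp (- \<beta> * N \<gamma>) times the measure of
   the complement, so it remains to bound the latter from below uniformly in \<gamma>.  If no such bound
   existed, then by compactness of the union of \<Gamma> and M, \<mu> would be the point mass at some z, and z
   would be fixed by \<Gamma> by quasi-invariance.

   A non-elementary \<Gamma> has no global fixed point z: an element g mapping the complement of a
   neighbourhood of z into a set W disjoint from that neighbourhood has an attracting fixed point p in W, and some h in \<Gamma> moves p
   towards another limit point.  For x outside W, choosing k(l) minimal such that
   e(l) = g^k(l) h g^-l maps x into W keeps e(l) x away from p and z, while e(l) p tends to p
   and e(l) z = z.  Hence the e(l) take finitely many values, which forces h p = p. *)
theory Submission
  imports Defs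
begin


section \<open>Locally uniform convergence and basic facts on convergence groups\<close>

text \<open>Finitely many of the neighbourhoods supplied by local uniformity cover \<open>K\<close>,
  and finitely many eventual statements hold simultaneously.\<close>

lemma loc_unif_conv_const_compactin:
  assumes f: "loc_unif_conv_const X S f x" and K: "compactin X K" "K \<subseteq> S"
    and U: "openin X U" "x \<in> U"
  shows "\<forall>\<^sub>F n in sequentially. \<forall>v\<in>K. f n v \<in> U"
proof -
  define \<V> where "\<V> = {V. openin (subtopology X S) V \<and> (\<forall>\<^sub>F n in sequentially. \<forall>v\<in>V. f n v \<in> U)}"
  have "K \<subseteq> \<Union>\<V>"
  proof
    fix v assume "v \<in> K"
    with f K(2) obtain V where "openin (subtopology X S) V" "v \<in> V"
      "\<forall>U. openin X U \<and> x \<in> U \<longrightarrow> (\<forall>\<^sub>F n in sequentially. \<forall>v\<in>V. f n v \<in> U)"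
      unfolding loc_unif_conv_const_def by blast
    then show "v \<in> \<Union>\<V>"
      using U by (auto simp: \<V>_def)
  qed
  moreover have "compactin (subtopology X S) K"
    using K by (simp add: compactin_subtopology)
  moreover have "\<forall>V\<in>\<V>. openin (subtopology X S) V"
    by (simp add: \<V>_def)
  ultimately have "\<exists>\<F>. finite \<F> \<and> \<F> \<subseteq> \<V> \<and> K \<subseteq> \<Union>\<F>"
    unfolding compactin_def by blast
  then obtain \<F> where \<F>: "finite \<F>" "\<F> \<subseteq> \<V>" "K \<subseteq> \<Union>\<F>"
    by blast
  have "\<forall>\<^sub>F n in sequentially. \<forall>V\<in>\<F>. \<forall>v\<in>V. f n v \<in> U"
    using \<F>(1,2) by (intro eventually_ball_finite) (auto simp: \<V>_def)
  then show ?thesis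
    by (rule eventually_mono) (use \<F>(3) in blast)
qed

lemma loc_unif_conv_const_at:
  assumes "loc_unif_conv_const X S f x" "v \<in> S" "openin X U" "x \<in> U"
  shows "\<forall>\<^sub>F n in sequentially. f n v \<in> U"
proof -
  obtain V where "v \<in> V" "\<forall>\<^sub>F n in sequentially. \<forall>v\<in>V. f n v \<in> U"
    using assms unfolding loc_unif_conv_const_def by meson
  then show ?thesis
    by (auto elim: eventually_mono)
qed

lemma convergence_groupD:
  assumes "convergence_group \<Gamma>"
  shows convergence_group_id: "id \<in> \<Gamma>"
    and convergence_group_comp: "\<And>f g. f \<in> \<Gamma> \<Longrightarrow> g \<in> \<Gamma> \<Longrightarrow> f \<circ> g \<in> \<Gamma>"
    and convergence_group_inv: "\<And>g. g \<in> \<Gamma> \<Longrightarrow> inv g \<in> \<Gamma>"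
    and convergence_group_homeo: "\<And>g. g \<in> \<Gamma> \<Longrightarrow> homeomorphic_map euclidean euclidean g"
proof -
  have sub: "subgroup \<Gamma> Homeo"
    using assms by (simp add: convergence_group_def)
  show "id \<in> \<Gamma>" "\<And>f g. f \<in> \<Gamma> \<Longrightarrow> g \<in> \<Gamma> \<Longrightarrow> f \<circ> g \<in> \<Gamma>"
    using subgroup.one_closed[OF sub] subgroup.m_closed[OF sub] by (simp_all add: Homeo_def)
  show "inv g \<in> \<Gamma>" if "g \<in> \<Gamma>" for g
    using subgroup.m_inv_closed[OF sub that] subgroup.subset[OF sub] that m_inv_Homeo by fastforce
  show "homeomorphic_map euclidean euclidean g" if "g \<in> \<Gamma>" for g
    using subgroup.subset[OF sub] that by (auto simp: Homeo_def)
qed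

lemma convergence_group_funpow:
  assumes "convergence_group \<Gamma>" "g \<in> \<Gamma>"
  shows "g ^^ n \<in> \<Gamma>"
proof (induction n)
  case 0
  show ?case using convergence_group_id[OF assms(1)] by (simp only: funpow.simps)
next
  case (Suc n)
  show ?case using convergence_group_comp[OF assms Suc] by (simp only: funpow.simps)
qed

lemma homeomorphic_map_euclideanD:
  assumes "homeomorphic_map euclidean euclidean g"
  shows "bij g" "\<And>U. open U \<Longrightarrow> open (g -` U)" "\<And>U. open U \<Longrightarrow> open (g ` U)"
proof -
  show "bij g"
    using homeomorphic_imp_injective_map[OF assms] homeomorphic_imp_surjective_map[OF assms]
    by (simp add: bij_def)
  show "open (g -` U)" if "open U" for U
    using homeomorphic_imp_continuous_map[OF assms] that
    by (simp add: continuous_on_open_vimage)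
  show "open (g ` U)" if "open U" for U
    using homeomorphic_imp_open_map[OF assms] that by (simp add: open_map_def)
qed

lemma convergence_group_subsequence:
  assumes "convergence_group \<Gamma>" "inj \<gamma>" "range \<gamma> \<subseteq> \<Gamma>"
  obtains x y and r :: "nat \<Rightarrow> nat" where "strict_mono r"
    "loc_unif_conv_const euclidean (UNIV - {y}) (\<lambda>j. \<gamma> (r j)) x"
proof -
  have "\<exists>x\<in>topspace euclidean. \<exists>y\<in>topspace euclidean. \<exists>r :: nat \<Rightarrow> nat. strict_mono r \<and>
      loc_unif_conv_const euclidean (topspace euclidean - {y}) (\<lambda>j. \<gamma> (r j)) x"
    using assms unfolding convergence_group_def convergence_action_def by blast
  then show ?thesis
    using that by auto
qed

lemma Hausdorff_euclideanD:
  fixes u v :: "'m::topological_space"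
  assumes "Hausdorff_space (euclidean :: 'm topology)" "u \<noteq> v"
  obtains U V :: "'m set" where "open U" "open V" "u \<in> U" "v \<in> V" "U \<inter> V = {}"
proof -
  have "\<exists>U V. open U \<and> open V \<and> u \<in> U \<and> v \<in> V \<and> U \<inter> V = {}"
    using assms unfolding Hausdorff_space_def disjnt_def by simp
  then show ?thesis
    using that by blast
qed

lemma closed_singleton_Hausdorff:
  assumes "Hausdorff_space (euclidean :: 'm::topological_space topology)"
  shows "closed {u :: 'm}"
  using assms closedin_Hausdorff_finite[of euclidean "{u}"] by simp

section \<open>Contracting elements and the absence of global fixed points\<close>

text \<open>The nesting \<open>g ^^ (k + 1) ` (- N) \<subseteq> g ^^ k ` (- N)\<close> upgrades the convergence of a subsequence
  of the powers of \<open>g\<close> to convergence of the powers.\<close>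

lemma contracting_element:
  fixes g :: "'m::topological_space \<Rightarrow> 'm"
  assumes cpt: "compact_space (euclidean :: 'm topology)"
    and haus: "Hausdorff_space (euclidean :: 'm topology)"
    and conv: "convergence_group \<Gamma>" and g: "g \<in> \<Gamma>" "g z = z"
    and WN: "open W" "open N" "W \<inter> N = {}" "z \<in> N" "g ` (- N) \<subseteq> W"
    and x: "x \<notin> W" "x \<notin> N"
  obtains p where "g p = p" "p \<in> W"
    "\<forall>V u. open V \<longrightarrow> p \<in> V \<longrightarrow> u \<noteq> z \<longrightarrow> (\<forall>\<^sub>F k in sequentially. (g ^^ k) u \<in> V)"
    "\<forall>V. open V \<longrightarrow> z \<in> V \<longrightarrow> (\<forall>\<^sub>F k in sequentially. (inv g ^^ k) x \<in> V)"
proof -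
  note gh = homeomorphic_map_euclideanD[OF convergence_group_homeo[OF conv g(1)]]
  have bij: "bij (g ^^ k)" for k
    using gh(1) by (simp add: bij_fn)
  have step: "g u \<in> W" if "u \<notin> N" for u
    using WN(5) that by blast
  have stay: "(g ^^ k) u \<notin> N" if "u \<notin> N" for u k
    by (induction k) (use that step WN(3) in auto)
  have inW: "(g ^^ k) u \<in> W" if "u \<notin> N" "k > 0" for u k
    using that stay[OF that(1), of "k - 1"] step by (cases k) auto
  have stayW: "(g ^^ k) u \<in> W" if "u \<in> W" for u k
    using that inW[of u k] WN(3) by (cases k) auto
  have zfix: "(g ^^ k) z = z" for k
    by (induction k) (use g in auto)
  \<comment> \<open>If two powers agreed, a positive power of \<open>g\<close> would fix
    \<open>x\<close>; but positive powers carry \<open>x\<close> into \<open>W\<close>, which does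
    not contain it.\<close>
  have inj: "inj (\<lambda>k. g ^^ k)"
  proof (rule linorder_injI)
    fix i j :: nat assume "i < j"
    show "g ^^ i \<noteq> g ^^ j"
    proof
      assume "g ^^ i = g ^^ j"
      moreover have "g ^^ j = g ^^ i \<circ> g ^^ (j - i)"
        using \<open>i < j\<close> by (simp flip: funpow_add)
      ultimately have "(g ^^ i) x = (g ^^ i) ((g ^^ (j - i)) x)"
        by (simp add: fun_eq_iff)
      then have "x = (g ^^ (j - i)) x"
        by (rule injD[OF bij_is_inj[OF bij]])
      then show False
        using inW[OF x(2), of "j - i"] x(1) \<open>i < j\<close> by simp
    qed
  qed
  obtain p y and r :: "nat \<Rightarrow> nat" where r: "strict_mono r"
    and lim: "loc_unif_conv_const euclidean (UNIV - {y}) (\<lambda>j. g ^^ r j) p"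
    by (rule convergence_group_subsequence[OF conv inj])
      (auto intro: convergence_group_funpow[OF conv g(1)])
  \<comment> \<open>An orbit that starts outside \<open>N\<close> never enters \<open>N\<close>, so
    its limit cannot lie in this open set. The starting point only has to avoid the exceptional
    point \<open>y\<close>, and of the distinct points \<open>x\<close> and \<open>g x\<close> at
    least one does.\<close>
  have noN: "p \<notin> N" if "u \<noteq> y" "u \<notin> N" for u
  proof
    assume "p \<in> N"
    then have "\<forall>\<^sub>F j in sequentially. (g ^^ r j) u \<in> N"
      using loc_unif_conv_const_at[OF lim, of u N] that WN(2) by simp
    then show False
      using stay[OF that(2)] by simp
  qed
  have "x \<noteq> g x" "g x \<notin> N"
    using x step[OF x(2)] WN(3) by auto
  then have "p \<notin> N"
    using noN[of x] noN[of "g x"] x(2) by (cases "x = y") auto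
  \<comment> \<open>Every power fixes \<open>z\<close>, so if \<open>z\<close> were not exceptional,
    the limit \<open>p\<close> would be \<open>z\<close> itself, which lies in
    \<open>N\<close>.\<close>
  have "y = z"
  proof (rule ccontr)
    assume "y \<noteq> z"
    have "p \<noteq> z" using \<open>p \<notin> N\<close> WN by auto
    then obtain U V where UV: "open U" "open V" "p \<in> U" "z \<in> V" "U \<inter> V = {}"
      by (rule Hausdorff_euclideanD[OF haus])
    then have "\<forall>\<^sub>F j in sequentially. (g ^^ r j) z \<in> U"
      using loc_unif_conv_const_at[OF lim, of z U] \<open>y \<noteq> z\<close> by simp
    then show False
      using UV by (auto simp: zfix)
  qed
  have "x \<noteq> z" "g x \<noteq> z"
    using x WN step[OF x(2)] by auto
  \<comment> \<open>Along the same subsequence both \<open>x\<close> and \<open>g x\<close> are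
    carried to \<open>p\<close>; as powers commute with \<open>g\<close>, continuity gives the limit
    \<open>g p\<close> for the orbit of \<open>g x\<close> as well.\<close>
  have gp: "g p = p"
  proof (rule ccontr)
    assume "g p \<noteq> p"
    then obtain U V where UV: "open U" "open V" "g p \<in> U" "p \<in> V" "U \<inter> V = {}"
      by (rule Hausdorff_euclideanD[OF haus])
    have "\<forall>\<^sub>F j in sequentially. (g ^^ r j) x \<in> g -` U"
      using loc_unif_conv_const_at[OF lim, of x "g -` U"] UV gh(2) \<open>x \<noteq> z\<close> \<open>y = z\<close> by simp
    moreover have "\<forall>\<^sub>F j in sequentially. (g ^^ r j) (g x) \<in> V"
      using loc_unif_conv_const_at[OF lim, of "g x" V] UV \<open>g x \<noteq> z\<close> \<open>y = z\<close> by simp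
    ultimately have "\<forall>\<^sub>F j in sequentially. False"
      by eventually_elim (use UV(5) in \<open>auto simp: funpow_swap1\<close>)
    then show False by simp
  qed
  have "p \<in> W"
    using gp \<open>p \<notin> N\<close> step by metis
  have compact_lim: "\<exists>m. \<forall>u\<in>K. (g ^^ m) u \<in> V" if "closed K" "z \<notin> K" "open V" "p \<in> V" for K V
  proof -
    have "compactin euclidean K"
      using closedin_compact_space[OF cpt, of K] that(1) by simp
    then have "\<forall>\<^sub>F j in sequentially. \<forall>u\<in>K. (g ^^ r j) u \<in> V"
      using loc_unif_conv_const_compactin[OF lim] that \<open>y = z\<close> by auto
    then show ?thesis
      by (auto simp: eventually_sequentially)
  qed
  show ?thesis
  proof
    show "g p = p" "p \<in> W" by fact+
  next
    show "\<forall>V u. open V \<longrightarrow> p \<in> V \<longrightarrow> u \<noteq> z \<longrightarrow> (\<forall>\<^sub>F k in sequentially. (g ^^ k) u \<in> V)"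
    proof (intro allI impI)
      fix V and u :: 'm assume V: "open V" "p \<in> V" and "u \<noteq> z"
      have "closed (- N)" "z \<notin> - N"
        using WN by (simp_all add: closed_Compl)
      \<comment> \<open>The power \<open>m\<close> sends all of \<open>- N\<close> into
        \<open>V\<close>, and the power \<open>i\<close> brings \<open>u\<close> into
        \<open>W\<close>, from where the orbit never meets \<open>N\<close>. Any later power is
        \<open>m\<close> applied to a point of that orbit.\<close>
      from compact_lim[OF this V] obtain m where m: "\<forall>u\<in>- N. (g ^^ m) u \<in> V" ..
      have "closed {u}" "z \<notin> {u}"
        using \<open>u \<noteq> z\<close> closed_singleton_Hausdorff[OF haus, of u] by simp_all
      from compact_lim[OF this WN(1) \<open>p \<in> W\<close>] obtain i where i: "(g ^^ i) u \<in> W"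
        by blast
      have "(g ^^ k) u \<in> V" if km: "m + i \<le> k" for k
      proof -
        obtain j where "k = m + i + j"
          using le_Suc_ex[OF km] by blast
        then have k: "k = m + (j + i)"
          by simp
        have "(g ^^ i) u \<notin> N"
          using i WN(3) by blast
        then show ?thesis
          using m stay by (simp add: k funpow_add)
      qed
      then show "\<forall>\<^sub>F k in sequentially. (g ^^ k) u \<in> V"
        by (auto simp: eventually_sequentially)
    qed
  next
    show "\<forall>V. open V \<longrightarrow> z \<in> V \<longrightarrow> (\<forall>\<^sub>F k in sequentially. (inv g ^^ k) x \<in> V)"
    proof (intro allI impI)
      fix V assume V: "open V" "z \<in> V"
      have "closed (- V)" "z \<notin> - V"
        using V by (simp_all add: closed_Compl)
      from compact_lim[OF this WN(1) \<open>p \<in> W\<close>]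
      obtain m where m: "\<forall>u\<in>- V. (g ^^ m) u \<in> W" ..
      \<comment> \<open>If the backward orbit were outside \<open>V\<close> at time
        \<open>k\<close>, then \<open>g ^^ m\<close> would take it into \<open>W\<close>, and the
        remaining \<open>k - m\<close> forward steps would keep it there; but they end at
        \<open>x\<close>.\<close>
      have "(inv g ^^ k) x \<in> V" if "k \<ge> m" for k
      proof (rule ccontr)
        assume "(inv g ^^ k) x \<notin> V"
        then have "(g ^^ ((k - m) + m)) ((inv g ^^ k) x) \<in> W"
          using m stayW by (simp add: funpow_add)
        moreover have "(g ^^ k) ((inv g ^^ k) x) = x"
          using fn_o_inv_fn_is_id[OF gh(1)] by (simp add: fun_eq_iff)
        ultimately show False
          using x(1) that by simp
      qed
      then show "\<forall>\<^sub>F k in sequentially. (inv g ^^ k) x \<in> V"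
        by (auto simp: eventually_sequentially)
    qed
  qed
qed

lemma non_elementary_obtains:
  assumes "non_elementary \<Gamma>"
  obtains a a' where "a \<in> limit_set \<Gamma>" "a' \<in> limit_set \<Gamma>" "a \<noteq> a'" "a \<noteq> z" "a' \<noteq> z"
proof -
  have "\<not> limit_set \<Gamma> \<subseteq> {z, b}" for b
  proof
    assume *: "limit_set \<Gamma> \<subseteq> {z, b}"
    have "card {z, b} \<le> 2"
      by (simp add: card_insert_if)
    moreover have "finite (limit_set \<Gamma>)" "card (limit_set \<Gamma>) \<le> card {z, b}"
      using * by (auto intro: finite_subset card_mono)
    ultimately show False
      using assms by (simp add: non_elementary_def)
  qed
  then obtain a where "a \<in> limit_set \<Gamma>" "a \<noteq> z"
    by blast
  moreover obtain a' where "a' \<in> limit_set \<Gamma>" "a' \<noteq> z" "a' \<noteq> a"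
    using \<open>\<And>b. \<not> limit_set \<Gamma> \<subseteq> {z, b}\<close>[of a] by blast
  ultimately show ?thesis
    using that by blast
qed

text \<open>The exceptional point of the sequence must be \<open>z\<close>: otherwise the sequence
  would carry the fixed point \<open>z\<close> towards \<open>a\<close>, which differs from
  it.\<close>

lemma limit_set_global_fixed_point:
  fixes \<Gamma> :: "('m::topological_space \<Rightarrow> 'm) set"
  assumes haus: "Hausdorff_space (euclidean :: 'm topology)"
    and fixed: "\<forall>g\<in>\<Gamma>. g z = z"
    and a: "a \<in> limit_set \<Gamma>" "a \<noteq> z"
  obtains \<gamma> where "range \<gamma> \<subseteq> \<Gamma>" "loc_unif_conv_const euclidean (UNIV - {z}) \<gamma> a"
proof -
  obtain y \<gamma> where \<gamma>: "range \<gamma> \<subseteq> \<Gamma>" "loc_unif_conv_const euclidean (UNIV - {y}) \<gamma> a"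
    using a by (auto simp: limit_set_def)
  have "y = z"
  proof (rule ccontr)
    assume "y \<noteq> z"
    obtain U V where UV: "open U" "open V" "a \<in> U" "z \<in> V" "U \<inter> V = {}"
      using a(2) by (rule Hausdorff_euclideanD[OF haus])
    then have "\<forall>\<^sub>F n in sequentially. \<gamma> n z \<in> U"
      using loc_unif_conv_const_at[OF \<gamma>(2), of z U] \<open>y \<noteq> z\<close> by simp
    moreover have "\<gamma> n z = z" for n
      using fixed \<gamma>(1) by blast
    ultimately show False
      using UV by auto
  qed
  then show ?thesis
    using \<gamma> that by blast
qed

lemma inj_imp_filterlim_at_top:
  assumes "inj (f :: nat \<Rightarrow> nat)"
  shows "filterlim f at_top sequentially"
proof -
  have "\<forall>\<^sub>F j in sequentially. f j \<ge> c" for c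
  proof -
    have "finite (f -` {..<c})"
      using assms by (intro finite_vimageI) auto
    then obtain m where "\<forall>j\<in>f -` {..<c}. j < m"
      using finite_nat_set_iff_bounded by blast
    then have "\<forall>j\<ge>m. f j \<ge> c"
      by (metis lessThan_iff not_le vimageI2)
    then show ?thesis
      by (auto simp: eventually_sequentially)
  qed
  then show ?thesis
    by (simp add: filterlim_at_top)
qed

text \<open>A convergence group acts properly discontinuously on triples of distinct points.\<close>

lemma finite_range_if_triple_separated:
  fixes e :: "nat \<Rightarrow> 'm::topological_space \<Rightarrow> 'm"
  assumes haus: "Hausdorff_space (euclidean :: 'm topology)"
    and conv: "convergence_group \<Gamma>" and e: "range e \<subseteq> \<Gamma>"
    and dist: "z \<noteq> p" "x \<noteq> z" "x \<noteq> p"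
    and ez: "\<And>l. e l z = z"
    and ep: "\<And>V. open V \<Longrightarrow> p \<in> V \<Longrightarrow> \<forall>\<^sub>F l in sequentially. e l p \<in> V"
    and sep: "open Oz" "z \<in> Oz" "open Op" "p \<in> Op"
      "\<forall>\<^sub>F l in sequentially. e l x \<notin> Oz \<and> e l x \<notin> Op"
  shows "finite (range e)"
proof (rule ccontr)
  assume "infinite (range e)"
  then obtain s :: "nat \<Rightarrow> 'm \<Rightarrow> 'm" where s: "inj s" "range s \<subseteq> range e"
    using infinite_countable_subset by blast
  obtain c y and r :: "nat \<Rightarrow> nat" where r: "strict_mono r"
    and lim: "loc_unif_conv_const euclidean (UNIV - {y}) (\<lambda>j. s (r j)) c"
    by (rule convergence_group_subsequence[OF conv s(1)]) (use s e in auto)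
  have "\<forall>i. \<exists>l. s i = e l"
    using s(2) by blast
  then obtain t where t: "\<And>i. s i = e (t i)"
    by metis
  \<comment> \<open>The indices \<open>t (r j)\<close> need not increase, but being distinct they
    tend to infinity; this is enough to transfer eventual statements from \<open>e\<close> to the
    convergent subsequence.\<close>
  have "inj (\<lambda>j. t (r j))"
  proof (rule injI)
    fix i j assume "t (r i) = t (r j)"
    then have "s (r i) = s (r j)"
      by (simp add: t)
    then show "i = j"
      using s(1) r by (simp add: inj_eq strict_mono_eq)
  qed
  then have t_top: "filterlim (\<lambda>j. t (r j)) at_top sequentially"
    by (rule inj_imp_filterlim_at_top)
  have sub: "\<forall>\<^sub>F j in sequentially. P (s (r j))" if "\<forall>\<^sub>F l in sequentially. P (e l)" for P
    using filterlim_iff[THEN iffD1, OF t_top, rule_format, OF that] by (simp add: t)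
  have lim_at: "\<forall>\<^sub>F j in sequentially. s (r j) v \<in> U" if "v \<noteq> y" "open U" "c \<in> U" for U v
    using loc_unif_conv_const_at[OF lim, of v U] that by simp
  have sz: "s j z = z" for j
    by (simp add: t ez)
  \<comment> \<open>Each of the three points, if it is not the exceptional \<open>y\<close>,
    constrains \<open>c\<close>: \<open>z\<close> forces \<open>c = z\<close>, \<open>p\<close>
    forces \<open>c = p\<close>, and \<open>x\<close> excludes both values. At least two of these
    constraints apply, and any two are contradictory.\<close>
  have c_eq_z: "c = z" if "z \<noteq> y"
  proof (rule ccontr)
    assume "c \<noteq> z"
    then obtain U V where UV: "open U" "open V" "c \<in> U" "z \<in> V" "U \<inter> V = {}"
      by (rule Hausdorff_euclideanD[OF haus])
    from lim_at[OF that UV(1,3)] show False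
      using UV by (auto simp: sz)
  qed
  have c_eq_p: "c = p" if "p \<noteq> y"
  proof (rule ccontr)
    assume "c \<noteq> p"
    then obtain U V where UV: "open U" "open V" "c \<in> U" "p \<in> V" "U \<inter> V = {}"
      by (rule Hausdorff_euclideanD[OF haus])
    from lim_at[OF that UV(1,3)] sub[OF ep[OF UV(2,4)]]
    have "\<forall>\<^sub>F j in sequentially. False"
      by eventually_elim (use UV in auto)
    then show False
      by simp
  qed
  have c_neq: "c \<noteq> z \<and> c \<noteq> p" if "x \<noteq> y"
  proof (rule ccontr)
    assume "\<not> (c \<noteq> z \<and> c \<noteq> p)"
    then have "c \<in> Oz \<union> Op"
      using sep by auto
    then have "\<forall>\<^sub>F j in sequentially. s (r j) x \<in> Oz \<union> Op"
      using lim_at[OF that, of "Oz \<union> Op"] sep(1,3) by (simp add: open_Un)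
    with sub[OF sep(5)] have "\<forall>\<^sub>F j in sequentially. False"
      by eventually_elim auto
    then show False
      by simp
  qed
  show False
    using c_eq_z c_eq_p c_neq dist by metis
qed

lemma non_elementary_no_global_fixed_point:
  fixes \<Gamma> :: "('m::topological_space \<Rightarrow> 'm) set"
  assumes cpt: "compact_space (euclidean :: 'm topology)"
    and haus: "Hausdorff_space (euclidean :: 'm topology)"
    and conv: "convergence_group \<Gamma>" and ne: "non_elementary \<Gamma>"
  shows "\<exists>g\<in>\<Gamma>. g z \<noteq> z"
proof (rule ccontr)
  assume "\<not> ?thesis"
  then have fixed_ball: "\<forall>g\<in>\<Gamma>. g z = z"
    by blast
  then have fixed: "g z = z" if "g \<in> \<Gamma>" for g
    using that by blast
  obtain a x where a: "a \<in> limit_set \<Gamma>" "x \<in> limit_set \<Gamma>" "a \<noteq> x" "a \<noteq> z" "x \<noteq> z"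
    by (rule non_elementary_obtains[OF ne])
  obtain \<gamma> where \<gamma>: "range \<gamma> \<subseteq> \<Gamma>" "loc_unif_conv_const euclidean (UNIV - {z}) \<gamma> a"
    by (rule limit_set_global_fixed_point[OF haus fixed_ball a(1,4)])
  obtain \<gamma>' where \<gamma>': "range \<gamma>' \<subseteq> \<Gamma>" "loc_unif_conv_const euclidean (UNIV - {z}) \<gamma>' x"
    by (rule limit_set_global_fixed_point[OF haus fixed_ball a(2,5)])
  obtain W0 N0 where WN0: "open W0" "open N0" "a \<in> W0" "z \<in> N0" "W0 \<inter> N0 = {}"
    using a(4) by (rule Hausdorff_euclideanD[OF haus])
  have "closed {x}"
    by (rule closed_singleton_Hausdorff[OF haus])
  \<comment> \<open>Removing \<open>x\<close> from both sets makes it a base point outside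
    \<open>W\<close> and \<open>N\<close>; \<open>a\<close> and \<open>z\<close> survive because
    they differ from \<open>x\<close>.\<close>
  define W N where "W = W0 - {x}" and "N = N0 - {x}"
  have WN: "open W" "open N" "W \<inter> N = {}" "z \<in> N" and aW: "a \<in> W" and x: "x \<notin> W" "x \<notin> N"
    using WN0 a \<open>closed {x}\<close> unfolding W_def N_def by (auto intro: open_Diff)
  have "compactin euclidean (- N)"
    using closedin_compact_space[OF cpt, of "- N"] WN(2) by (simp add: closed_Compl)
  then have "\<forall>\<^sub>F n in sequentially. \<forall>v\<in>- N. \<gamma> n v \<in> W"
    using loc_unif_conv_const_compactin[OF \<gamma>(2)] WN aW by auto
  then obtain n where "\<gamma> n ` (- N) \<subseteq> W"
    by (auto simp: eventually_sequentially)
  then obtain g where g: "g \<in> \<Gamma>" "g ` (- N) \<subseteq> W"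
    using \<gamma>(1) by blast
  have gz: "g z = z"
    by (rule fixed[OF g(1)])
  obtain p where p: "g p = p" "p \<in> W"
    and plim_all: "\<forall>V u. open V \<longrightarrow> p \<in> V \<longrightarrow> u \<noteq> z \<longrightarrow> (\<forall>\<^sub>F k in sequentially. (g ^^ k) u \<in> V)"
    and zlim_all: "\<forall>V. open V \<longrightarrow> z \<in> V \<longrightarrow> (\<forall>\<^sub>F k in sequentially. (inv g ^^ k) x \<in> V)"
    by (rule contracting_element[OF cpt haus conv g(1) gz WN g(2) x])
  note plim = plim_all[rule_format] and zlim = zlim_all[rule_format]
  have "p \<noteq> z" "p \<noteq> x"
    using p WN x by auto
  obtain h where h: "h \<in> \<Gamma>" "h p \<noteq> p"
  proof -
    obtain U V where UV: "open U" "open V" "p \<in> U" "x \<in> V" "U \<inter> V = {}"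
      using \<open>p \<noteq> x\<close> by (rule Hausdorff_euclideanD[OF haus])
    then have "\<forall>\<^sub>F n in sequentially. \<gamma>' n p \<in> V"
      using loc_unif_conv_const_at[OF \<gamma>'(2), of p V] \<open>p \<noteq> z\<close> by simp
    then obtain n where "\<gamma>' n p \<in> V"
      by (auto simp: eventually_sequentially)
    then have "\<gamma>' n p \<noteq> p"
      using UV by auto
    moreover have "\<gamma>' n \<in> \<Gamma>"
      using \<gamma>'(1) by auto
    ultimately show ?thesis
      using that by simp
  qed
  have hz: "h z = z"
    by (rule fixed[OF h(1)])
  note gh = homeomorphic_map_euclideanD[OF convergence_group_homeo[OF conv g(1)]]
  note hh = homeomorphic_map_euclideanD[OF convergence_group_homeo[OF conv h(1)]]
  have hp: "h p \<noteq> z"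
    using hz \<open>p \<noteq> z\<close> inj_eq[OF bij_is_inj[OF hh(1)], of p z] by simp
  define v where "v l = h ((inv g ^^ l) x)" for l
  have inv_pow: "inv g ^^ l \<in> \<Gamma>" for l
    using convergence_group_funpow[OF conv convergence_group_inv[OF conv g(1)]] .
  have vz: "v l \<noteq> z" for l
  proof
    assume "v l = z"
    then have "(h \<circ> inv g ^^ l) x = (h \<circ> inv g ^^ l) z"
      using fixed[OF inv_pow[of l]] hz by (simp add: v_def)
    moreover have "inj (h \<circ> inv g ^^ l)"
      by (rule bij_is_inj[OF homeomorphic_map_euclideanD(1)[OF convergence_group_homeo[OF conv
              convergence_group_comp[OF conv h(1) inv_pow]]]])
    ultimately show False
      using a(5) by (simp only: inj_eq)
  qed
  \<comment> \<open>As \<open>v l\<close> is not \<open>z\<close>, its forward orbit under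
    \<open>g\<close> converges to \<open>p\<close>, a point of the open set
    \<open>W\<close>.\<close>
  have hit: "\<exists>k. (g ^^ k) (v l) \<in> W" for l
    using plim[OF WN(1) p(2) vz[of l]] by (auto simp: eventually_sequentially)
  define k where "k l = (LEAST k. (g ^^ k) (v l) \<in> W)" for l
  have kW: "(g ^^ k l) (v l) \<in> W" for l
    unfolding k_def using hit by (rule LeastI_ex)
  have k_less: "(g ^^ j) (v l) \<notin> W" if "j < k l" for j l
    using not_less_Least[of j "\<lambda>k. (g ^^ k) (v l) \<in> W"] that by (simp add: k_def)
  \<comment> \<open>The backward orbit of \<open>x\<close> tends to \<open>z\<close>, and
    \<open>g ^^ j \<circ> h\<close> fixes \<open>z\<close>. For each fixed \<open>j\<close>, the
    point \<open>(g ^^ j) (v l)\<close> is therefore eventually in \<open>N\<close>, hence off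
    \<open>W\<close>, so the first hitting time grows without bound.\<close>
  have k_ge: "\<forall>\<^sub>F l in sequentially. k l > m" for m
  proof -
    have "\<forall>\<^sub>F l in sequentially. (g ^^ j) (v l) \<notin> W" for j
    proof -
      have gj: "g ^^ j \<in> \<Gamma>"
        using convergence_group_funpow[OF conv g(1)] .
      have "open ((g ^^ j \<circ> h) -` N)"
        using homeomorphic_map_euclideanD(2)[OF convergence_group_homeo[OF conv
            convergence_group_comp[OF conv gj h(1)]] WN(2)] .
      moreover have "z \<in> (g ^^ j \<circ> h) -` N"
        using WN(4) fixed[OF gj] hz by simp
      ultimately have "\<forall>\<^sub>F l in sequentially. (inv g ^^ l) x \<in> (g ^^ j \<circ> h) -` N"
        by (rule zlim)
      then show ?thesis
        by eventually_elim (use WN(3) in \<open>auto simp: v_def\<close>)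
    qed
    then have "\<forall>\<^sub>F l in sequentially. \<forall>j\<in>{..m}. (g ^^ j) (v l) \<notin> W"
      by (intro eventually_ball_finite) auto
    then show ?thesis
      by eventually_elim (use kW in \<open>force simp: not_le[symmetric]\<close>)
  qed
  have "\<forall>\<^sub>F l in sequentially. m \<le> k l" for m
    using k_ge[of m] by eventually_elim simp
  then have k_top: "filterlim k at_top sequentially"
    by (simp add: filterlim_at_top)
  define e where "e l = g ^^ k l \<circ> h \<circ> inv g ^^ l" for l
  have e\<Gamma>: "e l \<in> \<Gamma>" for l
    unfolding e_def using convergence_group_funpow[OF conv g(1)] h(1) inv_pow
    by (intro convergence_group_comp[OF conv])
  have ip: "(inv g ^^ l) p = p" for l
    by (induction l) (use p(1) inv_f_f[OF bij_is_inj[OF gh(1)], of p] in auto)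
  have gp: "(g ^^ l) p = p" for l
    by (induction l) (use p(1) in auto)
  \<comment> \<open>Powers of \<open>inv g\<close> fix \<open>p\<close>, so \<open>e l p\<close> is
    \<open>(g ^^ k l) (h p)\<close>, which tends to \<open>p\<close> since \<open>h p\<close> is not
    \<open>z\<close> and \<open>k l\<close> tends to infinity.\<close>
  have ep: "\<forall>\<^sub>F l in sequentially. e l p \<in> V" if "open V" "p \<in> V" for V
    using filterlim_iff[THEN iffD1, OF k_top, rule_format, OF plim[OF that hp]]
    by (simp add: e_def ip)
  have ex: "e l x \<notin> g ` W" if "k l > 0" for l
  proof
    assume "e l x \<in> g ` W"
    moreover have "e l x = g ((g ^^ (k l - 1)) (v l))"
      using that by (cases "k l") (simp_all add: e_def v_def)
    ultimately have "(g ^^ (k l - 1)) (v l) \<in> W"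
      using bij_is_inj[OF gh(1)] by (simp add: inj_image_mem_iff)
    then show False
      using k_less[of "k l - 1" l] that by simp
  qed
  have exW: "e l x \<in> W" for l
    using kW[of l] by (simp add: e_def v_def)
  have ev: "\<forall>\<^sub>F l in sequentially. e l x \<notin> N \<and> e l x \<notin> g ` W"
    using k_ge[of 0] by eventually_elim (use ex exW WN(3) in blast)
  have pgW: "p \<in> g ` W"
    using p by (metis imageI)
  have "finite (range e)"
    by (rule finite_range_if_triple_separated[OF haus conv _ \<open>p \<noteq> z\<close>[symmetric] a(5)
          \<open>p \<noteq> x\<close>[symmetric] fixed[OF e\<Gamma>] ep WN(2,4) gh(3)[OF WN(1)] pgW ev]) (use e\<Gamma> in auto)
  \<comment> \<open>A value taken infinitely often is compatible with \<open>e l p\<close> tending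
    to \<open>p\<close> only if \<open>e l0\<close> fixes \<open>p\<close>; cancelling the power of
    \<open>g\<close>, which fixes \<open>p\<close> too, leaves \<open>h p = p\<close>.\<close>
  then obtain l0 where l0: "infinite {l. e l = e l0}"
    using pigeonhole_infinite[of UNIV e] by auto
  have "h p = p"
  proof (rule ccontr)
    assume "h p \<noteq> p"
    have "e l0 p \<noteq> p"
    proof
      assume "e l0 p = p"
      then have "(g ^^ k l0) (h p) = (g ^^ k l0) p"
        by (simp add: e_def ip gp)
      then show False
        using \<open>h p \<noteq> p\<close> by (simp add: inj_eq[OF bij_is_inj[OF bij_fn[OF gh(1)]]])
    qed
    then obtain U V where UV: "open U" "open V" "e l0 p \<in> U" "p \<in> V" "U \<inter> V = {}"
      by (rule Hausdorff_euclideanD[OF haus])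
    obtain m where "\<forall>l\<ge>m. e l p \<in> V"
      using ep[OF UV(2,4)] by (auto simp: eventually_sequentially)
    moreover obtain l where "l \<ge> m" "e l = e l0"
      using l0 unfolding infinite_nat_iff_unbounded_le by blast
    ultimately show False
      using UV by force
  qed
  then show False
    using h(2) by simp
qed


section \<open>Measures of images and quasi-invariance\<close>

text \<open>The image of \<open>A\<close> under \<gamma> is its preimage under
  \<open>inv \<gamma>\<close>, so its measure is the integral over \<open>A\<close> of the density
  of the pushforward under \<open>inv \<gamma>\<close>. That density is controlled by
  \<open>\<sigma> \<gamma>\<close>, as \<open>inv (inv \<gamma>) = \<gamma>\<close>. The factor
  \<open>\<bar>\<beta>\<bar>\<close> allows for either sign of \<beta>.\<close>

lemma C_coarse_PS_measure_image_bounds: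
  fixes \<gamma> :: "'m::topological_space \<Rightarrow> 'm"
  assumes PS: "C_coarse_PS_measure \<Gamma> \<sigma> C \<beta> \<mu>"
    and \<gamma>: "inv \<gamma> \<in> \<Gamma>" "homeomorphic_map euclidean euclidean \<gamma>"
    and A: "A \<in> sets borel" and \<sigma>: "\<And>x. x \<in> A \<Longrightarrow> \<bar>\<sigma> \<gamma> x - s\<bar> \<le> D"
  shows "exp (- C - \<bar>\<beta>\<bar> * D - \<beta> * s) * measure \<mu> A \<le> measure \<mu> (\<gamma> ` A)"
    and "measure \<mu> (\<gamma> ` A) \<le> exp (C + \<bar>\<beta>\<bar> * D - \<beta> * s) * measure \<mu> A"
proof -
  have sets_\<mu>: "sets \<mu> = sets borel" and "prob_space \<mu>"
    using PS by (auto simp: C_coarse_PS_measure_def)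
  then interpret prob_space \<mu> by simp
  have bij: "bij \<gamma>"
    by (rule homeomorphic_map_euclideanD(1)[OF \<gamma>(2)])
  have inv_inv: "inv (inv \<gamma>) = \<gamma>"
    using bij by (rule inv_inv_eq)
  have "continuous_on UNIV (inv \<gamma>)"
    using homeomorphic_imp_continuous_map[OF homeomorphic_map_inv(1)[OF \<gamma>(2)]] by simp
  then have meas: "inv \<gamma> \<in> measurable \<mu> borel"
    using borel_measurable_continuous_onI measurable_cong_sets[OF sets_\<mu> refl] by blast
  define \<nu> where "\<nu> = distr \<mu> borel (inv \<gamma>)"
  define f where "f = RN_deriv \<mu> \<nu>"
  have ac: "absolutely_continuous \<mu> \<nu>"
    and AE_f: "AE x in \<mu>. ennreal (exp (- C - \<beta> * \<sigma> \<gamma> x)) \<le> f x \<and>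
      f x \<le> ennreal (exp (C - \<beta> * \<sigma> \<gamma> x))"
    using PS \<gamma>(1) by (auto simp: C_coarse_PS_measure_def \<nu>_def f_def inv_inv)
  have A': "A \<in> sets \<mu>"
    using A sets_\<mu> by simp
  have "inv \<gamma> -` A \<inter> space \<mu> = \<gamma> ` A"
    using bij_vimage_eq_inv_image[OF bij_imp_bij_inv[OF bij], of A] inv_inv
      sets_eq_imp_space_eq[OF sets_\<mu>] by simp
  then have "emeasure \<mu> (\<gamma> ` A) = emeasure \<nu> A"
    using emeasure_distr[OF meas A] by (simp add: \<nu>_def)
  also have "\<dots> = emeasure (density \<mu> f) A"
    using density_RN_deriv[OF ac] sets_\<mu> by (simp add: f_def \<nu>_def)
  also have "\<dots> = (\<integral>\<^sup>+x. f x * indicator A x \<partial>\<mu>)"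
    using A' by (simp add: emeasure_density f_def)
  finally have int: "emeasure \<mu> (\<gamma> ` A) = (\<integral>\<^sup>+x. f x * indicator A x \<partial>\<mu>)" .
  have \<beta>\<sigma>: "\<bar>\<beta> * \<sigma> \<gamma> x - \<beta> * s\<bar> \<le> \<bar>\<beta>\<bar> * D" if "x \<in> A" for x
    using mult_left_mono[OF \<sigma>[OF that] abs_ge_zero[of \<beta>]]
    by (simp add: right_diff_distrib flip: abs_mult)
  have "ennreal (exp (- C - \<bar>\<beta>\<bar> * D - \<beta> * s)) * emeasure \<mu> A
      = (\<integral>\<^sup>+x. ennreal (exp (- C - \<bar>\<beta>\<bar> * D - \<beta> * s)) * indicator A x \<partial>\<mu>)"
    using A' by (simp add: nn_integral_cmult_indicator)
  also have "\<dots> \<le> emeasure \<mu> (\<gamma> ` A)"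
    unfolding int
  proof (rule nn_integral_mono_AE, use AE_f in eventually_elim)
    fix x assume f: "ennreal (exp (- C - \<beta> * \<sigma> \<gamma> x)) \<le> f x \<and>
      f x \<le> ennreal (exp (C - \<beta> * \<sigma> \<gamma> x))"
    have "ennreal (exp (- C - \<bar>\<beta>\<bar> * D - \<beta> * s)) \<le> f x" if "x \<in> A"
    proof -
      have "exp (- C - \<bar>\<beta>\<bar> * D - \<beta> * s) \<le> exp (- C - \<beta> * \<sigma> \<gamma> x)"
        using \<beta>\<sigma>[OF that] by simp
      then show ?thesis
        using f by (meson ennreal_leI order_trans)
    qed
    then show "ennreal (exp (- C - \<bar>\<beta>\<bar> * D - \<beta> * s)) * indicator A x \<le> f x * indicator A x"
      by (auto simp: indicator_def)
  qed
  finally show "exp (- C - \<bar>\<beta>\<bar> * D - \<beta> * s) * measure \<mu> A \<le> measure \<mu> (\<gamma> ` A)"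
    by (simp add: emeasure_eq_measure flip: ennreal_mult)
  have "emeasure \<mu> (\<gamma> ` A) \<le> (\<integral>\<^sup>+x. ennreal (exp (C + \<bar>\<beta>\<bar> * D - \<beta> * s)) * indicator A x \<partial>\<mu>)"
    unfolding int
  proof (rule nn_integral_mono_AE, use AE_f in eventually_elim)
    fix x assume f: "ennreal (exp (- C - \<beta> * \<sigma> \<gamma> x)) \<le> f x \<and>
      f x \<le> ennreal (exp (C - \<beta> * \<sigma> \<gamma> x))"
    have "f x \<le> ennreal (exp (C + \<bar>\<beta>\<bar> * D - \<beta> * s))" if "x \<in> A"
    proof -
      have "exp (C - \<beta> * \<sigma> \<gamma> x) \<le> exp (C + \<bar>\<beta>\<bar> * D - \<beta> * s)"
        using \<beta>\<sigma>[OF that] by simp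
      then show ?thesis
        using f by (meson ennreal_leI order_trans)
    qed
    then show "f x * indicator A x \<le> ennreal (exp (C + \<bar>\<beta>\<bar> * D - \<beta> * s)) * indicator A x"
      by (auto simp: indicator_def)
  qed
  also have "\<dots> = ennreal (exp (C + \<bar>\<beta>\<bar> * D - \<beta> * s)) * emeasure \<mu> A"
    using A' by (simp add: nn_integral_cmult_indicator)
  finally show "measure \<mu> (\<gamma> ` A) \<le> exp (C + \<bar>\<beta>\<bar> * D - \<beta> * s) * measure \<mu> A"
    by (simp add: emeasure_eq_measure flip: ennreal_mult)
qed

text \<open>The complement of \<open>z\<close> is null, and by absolute continuity of the
  pushforward so is its preimage under \<open>g\<close>. If \<open>g\<close> moved \<open>z\<close>,
  these two null sets would cover the space.\<close>

lemma C_coarse_PS_measure_concentrated_fixed: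
  fixes \<Gamma> :: "('m::topological_space \<Rightarrow> 'm) set"
  assumes PS: "C_coarse_PS_measure \<Gamma> \<sigma> C \<beta> \<mu>"
    and g: "g \<in> \<Gamma>" "homeomorphic_map euclidean euclidean g"
    and z: "closed {z}" "measure \<mu> (UNIV - {z}) = 0"
  shows "g z = z"
proof (rule ccontr)
  assume "g z \<noteq> z"
  have sets_\<mu>: "sets \<mu> = sets borel" and "prob_space \<mu>"
    and ac: "absolutely_continuous \<mu> (distr \<mu> borel g)"
    using PS g by (auto simp: C_coarse_PS_measure_def)
  then interpret prob_space \<mu> by simp
  have space_\<mu>: "space \<mu> = UNIV"
    using sets_eq_imp_space_eq[OF sets_\<mu>] by simp
  have "continuous_on UNIV g"
    using homeomorphic_imp_continuous_map[OF g(2)] by simp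
  then have meas: "g \<in> measurable \<mu> borel"
    using borel_measurable_continuous_onI measurable_cong_sets[OF sets_\<mu> refl] by blast
  have Z: "UNIV - {z} \<in> sets borel"
    using z(1) by (auto intro: borel_open)
  then have null: "UNIV - {z} \<in> null_sets \<mu>"
    using z(2) sets_\<mu> by (simp add: null_sets_def emeasure_eq_measure)
  then have "UNIV - {z} \<in> null_sets (distr \<mu> borel g)"
    using ac by (auto simp: absolutely_continuous_def)
  then have "g -` (UNIV - {z}) \<in> null_sets \<mu>"
    using null_sets_distr_iff[OF meas] Z by (simp add: space_\<mu>)
  with null have "(UNIV - {z}) \<union> g -` (UNIV - {z}) \<in> null_sets \<mu>"
    by (rule null_sets.Un)
  moreover have "(UNIV - {z}) \<union> g -` (UNIV - {z}) = space \<mu>"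
    using \<open>g z \<noteq> z\<close> by (auto simp: space_\<mu>)
  ultimately show False
    using emeasure_space_1 by (simp add: null_sets_def)
qed

section \<open>Balls of a compatible metric and their complements\<close>

text \<open>Holds by continuity of the inclusion \<open>Inr\<close>; it makes the ball complements
  that define shadows Borel sets.\<close>

lemma compatible_metric_open_ball:
  fixes \<Gamma> :: "('m::topological_space \<Rightarrow> 'm) set"
  assumes "compatible_metric \<Gamma> d"
  shows "open {x. Inr x \<in> Metric_space.mball (\<Gamma> <+> UNIV) d c r}"
proof -
  interpret Metric_space "\<Gamma> <+> UNIV" d
    using assms by (simp add: compatible_metric_def)
  have "embedding_map euclidean mtopology (Inr :: 'm \<Rightarrow> ('m \<Rightarrow> 'm) + 'm)"
    using assms by (simp add: compatible_metric_def Let_def)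
  then have "continuous_map euclidean mtopology (Inr :: 'm \<Rightarrow> ('m \<Rightarrow> 'm) + 'm)"
    unfolding embedding_map_def
    using continuous_map_into_fulltopology homeomorphic_imp_continuous_map by blast
  from openin_continuous_map_preimage[OF this openin_mball[of c r]] show ?thesis
    by simp
qed

text \<open>Otherwise the complements of smaller and smaller balls around group elements have measure tending
  to \<open>0\<close>, and then \<open>\<mu>\<close> lives on the limit of these elements in the compact space \<open>\<Gamma> <+> UNIV\<close>.\<close>

lemma measure_ball_complement_lower_bound:
  fixes \<Gamma> :: "('m::topological_space \<Rightarrow> 'm) set"
  assumes d: "compatible_metric \<Gamma> d"
    and \<mu>: "sets \<mu> = sets borel" "finite_measure \<mu>"
    and closed_pt: "\<And>z::'m. closed {z}"
    and spread: "\<And>z. measure \<mu> (UNIV - {z}) > 0"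
  shows "\<exists>\<epsilon>>0. \<exists>\<delta>>0. \<forall>g\<in>\<Gamma>.
    \<delta> \<le> measure \<mu> {x. Inr x \<notin> Metric_space.mball (\<Gamma> <+> UNIV) d (Inl g) \<epsilon>}"
proof (rule ccontr)
  interpret Metric_space "\<Gamma> <+> UNIV" d
    using d by (simp add: compatible_metric_def)
  interpret \<mu>: finite_measure \<mu>
    by fact
  define K where "K c r = {x :: 'm. Inr x \<notin> mball c r}" for c r
  have K_sets: "K c r \<in> sets \<mu>" for c r
  proof -
    have "K c r = - {x. Inr x \<in> mball c r}"
      by (auto simp: K_def)
    then show ?thesis
      using compatible_metric_open_ball[OF d, of c r] \<mu>(1) by simp
  qed
  assume "\<not> ?thesis"
  then have neg: "\<exists>g\<in>\<Gamma>. measure \<mu> (K (Inl g) \<epsilon>) < \<delta>" if "\<epsilon> > 0" "\<delta> > 0" for \<epsilon> \<delta>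
    using that unfolding K_def by (meson not_le)
  have "\<forall>n. \<exists>g\<in>\<Gamma>. measure \<mu> (K (Inl g) (inverse (real (Suc n)))) < inverse (real (Suc n))"
    by (intro allI neg) simp_all
  then obtain g where g: "\<And>n. g n \<in> \<Gamma>"
    "\<And>n. measure \<mu> (K (Inl (g n)) (inverse (real (Suc n)))) < inverse (real (Suc n))"
    by metis
  have "compact_space mtopology"
    using d by (simp add: compatible_metric_def Let_def)
  moreover have "range (\<lambda>n. Inl (g n)) \<subseteq> \<Gamma> <+> UNIV"
    using g(1) by auto
  ultimately have "\<exists>l r. l \<in> \<Gamma> <+> UNIV \<and> strict_mono r \<and>
      limitin mtopology ((\<lambda>n. Inl (g n)) \<circ> r) l sequentially"
    unfolding compact_space_sequentially by blast
  then obtain l and r :: "nat \<Rightarrow> nat" where l: "l \<in> \<Gamma> <+> UNIV" and r: "strict_mono r"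
    and lim: "limitin mtopology (\<lambda>n. Inl (g (r n))) l sequentially"
    by (auto simp: o_def)
  have K_zero: "measure \<mu> (K l \<delta>) = 0" if "\<delta> > 0" for \<delta>
  proof -
    have "measure \<mu> (K l \<delta>) \<le> 0 + e" if "e > 0" for e
    proof -
      \<comment> \<open>For large \<open>n\<close>, the centre \<open>g (r n)\<close> is within
        \<open>\<delta> / 2\<close> of \<open>l\<close> and its radius is below both
        \<open>\<delta> / 2\<close> and \<open>e\<close>. Its ball then lies in the \<delta>-ball
        around \<open>l\<close>, so the complement \<open>K l \<delta>\<close> sits inside a set of
        measure below \<open>e\<close>.\<close>
      obtain m where m: "inverse (real (Suc m)) < min e (\<delta> / 2)"
        using reals_Archimedean[of "min e (\<delta> / 2)"] \<open>e > 0\<close> \<open>\<delta> > 0\<close> by auto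
      obtain n0 where n0: "\<And>n. n \<ge> n0 \<Longrightarrow> d (Inl (g (r n))) l < \<delta> / 2"
        using lim \<open>\<delta> > 0\<close> unfolding limit_metric_sequentially by (meson half_gt_zero)
      define n where "n = max m n0"
      have "m \<le> r n"
        using seq_suble[OF r, of n] by (simp add: n_def)
      then have rn: "inverse (real (Suc (r n))) < min e (\<delta> / 2)"
        using m by (smt (verit) inverse_less_iff_less of_nat_0_less_iff of_nat_mono not_less_eq_eq
            Suc_le_mono zero_less_Suc le_imp_inverse_le)
      have "K l \<delta> \<subseteq> K (Inl (g (r n))) (inverse (real (Suc (r n))))"
      proof
        fix x assume x: "x \<in> K l \<delta>"
        show "x \<in> K (Inl (g (r n))) (inverse (real (Suc (r n))))"
        proof (rule ccontr)
          assume "x \<notin> K (Inl (g (r n))) (inverse (real (Suc (r n))))"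
          then have "d (Inl (g (r n))) (Inr x) < \<delta> / 2"
            using rn by (simp add: K_def)
          moreover have "d l (Inl (g (r n))) < \<delta> / 2"
            using n0[of n] by (simp add: n_def commute)
          moreover have "d l (Inr x) \<le> d l (Inl (g (r n))) + d (Inl (g (r n))) (Inr x)"
            using l g(1) by (intro triangle) auto
          ultimately have "x \<notin> K l \<delta>"
            using l by (simp add: K_def InrI)
          then show False
            using x by simp
        qed
      qed
      then have "measure \<mu> (K l \<delta>) \<le> measure \<mu> (K (Inl (g (r n))) (inverse (real (Suc (r n)))))"
        using K_sets by (intro \<mu>.finite_measure_mono)
      also have "\<dots> < inverse (real (Suc (r n)))"
        by (rule g(2))
      finally show ?thesis
        using rn by simp
    qed
    then have "measure \<mu> (K l \<delta>) \<le> 0"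
      by (rule field_le_epsilon)
    then show ?thesis
      by (simp add: measure_le_0_iff)
  qed
  have "K l (inverse (real (Suc n))) \<in> null_sets \<mu>" for n
    using K_zero[of "inverse (real (Suc n))"] K_sets
    by (simp add: null_sets_def \<mu>.emeasure_eq_measure)
  then have null: "(\<Union>n. K l (inverse (real (Suc n)))) \<in> null_sets \<mu>"
    by (rule null_sets_UN)
  have far: "x \<in> (\<Union>n. K l (inverse (real (Suc n))))" if "Inr x \<noteq> l" for x
  proof -
    have "Inr x \<in> \<Gamma> <+> UNIV"
      by auto
    then have "d l (Inr x) > 0"
      using zero[OF l] nonneg[of l "Inr x"] that by (auto simp: less_le)
    then obtain n where "inverse (real (Suc n)) < d l (Inr x)"
      using reals_Archimedean by blast
    then have "x \<in> K l (inverse (real (Suc n)))"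
      by (simp add: K_def)
    then show ?thesis
      by blast
  qed
  \<comment> \<open>If \<open>l\<close> is a point of the space, that point is the only choice in
    general; if \<open>l\<close> is a group element, every \<open>x\<close> differs from it and any
    \<open>z\<close> will do.\<close>
  obtain z where "UNIV - {z} \<subseteq> {x. Inr x \<noteq> l}"
    by (cases l) auto
  then have sub: "UNIV - {z} \<subseteq> (\<Union>n. K l (inverse (real (Suc n))))"
    using far by auto
  have "UNIV - {z} \<in> sets \<mu>"
    using closed_pt \<mu>(1) by (auto intro: borel_open)
  from null_sets_subset[OF null this sub] show False
    using spread[of z] by (simp add: null_sets_def measure_def)
qed

section \<open>The two-sided shadow estimate\<close>

theorem theorem6p1:
  fixes \<Gamma> :: "('m::topological_space \<Rightarrow> 'm) set"
    and d :: "('m \<Rightarrow> 'm) + 'm \<Rightarrow> ('m \<Rightarrow> 'm) + 'm \<Rightarrow> real"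
    and \<sigma> :: "('m \<Rightarrow> 'm) \<Rightarrow> 'm \<Rightarrow> real"
    and N :: "('m \<Rightarrow> 'm) \<Rightarrow> real"
    and \<mu> :: "'m measure"
    and \<beta> :: real
  assumes "compact_space (euclidean :: 'm topology)"
    and "metrizable_space (euclidean :: 'm topology)"
    and "convergence_group \<Gamma>" and "non_elementary \<Gamma>"
    and "compatible_metric \<Gamma> d"
    and "expanding_coarse_cocycle \<Gamma> d \<sigma>"
    and "magnitude \<Gamma> d \<sigma> N"
    and "coarse_PS_measure \<Gamma> \<sigma> \<beta> \<mu>"
  shows "\<exists>\<epsilon>\<^sub>0>0. \<forall>\<epsilon>. 0 < \<epsilon> \<and> \<epsilon> < \<epsilon>\<^sub>0 \<longrightarrow>
           (\<exists>C>1. \<forall>\<gamma>\<in>\<Gamma>.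
              (1 / C) * exp (- \<beta> * N \<gamma>) \<le> measure \<mu> (shadow \<Gamma> d \<epsilon> \<gamma>) \<and>
              measure \<mu> (shadow \<Gamma> d \<epsilon> \<gamma>) \<le> C * exp (- \<beta> * N \<gamma>))"
proof -
  have haus: "Hausdorff_space (euclidean :: 'm topology)"
    using assms(2) by (rule metrizable_imp_Hausdorff_space)
  have closed_pt: "closed {z}" for z :: 'm
    by (rule closed_singleton_Hausdorff[OF haus])
  note conv = \<open>convergence_group \<Gamma>\<close> and d = \<open>compatible_metric \<Gamma> d\<close>
  interpret Metric_space "\<Gamma> <+> UNIV" d
    using d by (simp add: compatible_metric_def)
  obtain C\<^sub>0 where PS: "C_coarse_PS_measure \<Gamma> \<sigma> C\<^sub>0 \<beta> \<mu>"
    using \<open>coarse_PS_measure \<Gamma> \<sigma> \<beta> \<mu>\<close> by (auto simp: coarse_PS_measure_def)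
  have sets_\<mu>: "sets \<mu> = sets borel" and "prob_space \<mu>"
    using PS by (auto simp: C_coarse_PS_measure_def)
  interpret prob_space \<mu>
    by fact
  have spread: "measure \<mu> (UNIV - {z}) > 0" for z
  proof (rule ccontr)
    assume "\<not> ?thesis"
    then have "measure \<mu> (UNIV - {z}) = 0"
      by (simp add: zero_less_measure_iff)
    then have "\<forall>g\<in>\<Gamma>. g z = z"
      using C_coarse_PS_measure_concentrated_fixed[OF PS _ _ closed_pt]
        convergence_group_homeo[OF conv] by blast
    then show False
      using non_elementary_no_global_fixed_point[OF assms(1) haus conv assms(4), of z] by blast
  qed
  have "\<exists>\<epsilon>>0. \<exists>\<delta>>0. \<forall>g\<in>\<Gamma>. \<delta> \<le> measure \<mu> {x. Inr x \<notin> mball (Inl g) \<epsilon>}"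
    by (rule measure_ball_complement_lower_bound[OF d sets_\<mu> finite_measure_axioms
          closed_pt spread])
  then obtain \<epsilon>\<^sub>0 \<delta> where \<epsilon>\<^sub>0: "\<epsilon>\<^sub>0 > 0" and \<delta>: "\<delta> > 0"
    and low: "\<And>g. g \<in> \<Gamma> \<Longrightarrow> \<delta> \<le> measure \<mu> {x. Inr x \<notin> mball (Inl g) \<epsilon>\<^sub>0}"
    by blast
  show ?thesis
  proof (rule exI[of _ \<epsilon>\<^sub>0], intro conjI allI impI \<epsilon>\<^sub>0, elim conjE)
    fix \<epsilon> :: real assume \<epsilon>: "0 < \<epsilon>" "\<epsilon> < \<epsilon>\<^sub>0"
    \<comment> \<open>Outside an open \<epsilon>-ball the distance is only known to be at least
      \<epsilon>, whereas the magnitude bound asks for a strict inequality; half of \<epsilon>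
      provides it.\<close>
    have "\<epsilon> / 2 > 0"
      using \<epsilon>(1) by simp
    then obtain D where D: "\<And>x \<gamma>. \<gamma> \<in> \<Gamma> \<Longrightarrow> d (Inr x) (Inl (inv \<gamma>)) > \<epsilon> / 2 \<Longrightarrow>
        N \<gamma> - D \<le> \<sigma> \<gamma> x \<and> \<sigma> \<gamma> x \<le> N \<gamma> + D"
      using \<open>magnitude \<Gamma> d \<sigma> N\<close> unfolding magnitude_def by meson
    define c where "c = exp (C\<^sub>0 + \<bar>\<beta>\<bar> * D)"
    \<comment> \<open>The summand \<open>c / \<delta>\<close> serves the lower bound,
      \<open>c\<close> the upper bound, and \<open>1\<close> makes the constant exceed one.\<close>
    define C where "C = c / \<delta> + c + 1"
    have "c > 0" "c / \<delta> > 0"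
      using \<delta> by (simp_all add: c_def)
    then have C: "C > 1" "c \<le> C" "c / \<delta> \<le> C"
      by (simp_all add: C_def)
    have "1 / C \<le> 1 / (c / \<delta>)"
      using C \<open>c / \<delta> > 0\<close> by (intro divide_left_mono mult_pos_pos) linarith+
    then have inv_C: "1 / C \<le> \<delta> / c"
      by simp
    show "\<exists>C>1. \<forall>\<gamma>\<in>\<Gamma>.
        (1 / C) * exp (- \<beta> * N \<gamma>) \<le> measure \<mu> (shadow \<Gamma> d \<epsilon> \<gamma>) \<and>
        measure \<mu> (shadow \<Gamma> d \<epsilon> \<gamma>) \<le> C * exp (- \<beta> * N \<gamma>)"
    proof (intro exI[of _ C] conjI ballI C(1))
      fix \<gamma> assume \<gamma>: "\<gamma> \<in> \<Gamma>"
      note inv\<gamma> = convergence_group_inv[OF conv \<gamma>]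
      define A where "A r = {x. Inr x \<notin> mball (Inl (inv \<gamma>)) r}" for r
      have A_sets: "A r \<in> sets borel" for r
      proof -
        have "A r = - {x. Inr x \<in> mball (Inl (inv \<gamma>)) r}"
          by (auto simp: A_def)
        then show ?thesis
          using compatible_metric_open_ball[OF d, of "Inl (inv \<gamma>)" r] by simp
      qed
      have "\<bar>\<sigma> \<gamma> x - N \<gamma>\<bar> \<le> D" if "x \<in> A \<epsilon>" for x
      proof -
        have "Inr x \<in> \<Gamma> <+> UNIV" "Inl (inv \<gamma>) \<in> \<Gamma> <+> UNIV"
          using inv\<gamma> by auto
        then have "d (Inr x) (Inl (inv \<gamma>)) \<ge> \<epsilon>"
          using that by (auto simp: A_def commute)
        then have "d (Inr x) (Inl (inv \<gamma>)) > \<epsilon> / 2"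
          using \<epsilon>(1) by linarith
        from D[OF \<gamma> this] show ?thesis
          by linarith
      qed
      note bounds = C_coarse_PS_measure_image_bounds[OF PS inv\<gamma> convergence_group_homeo[OF conv \<gamma>]
          A_sets this]
      have shadow: "shadow \<Gamma> d \<epsilon> \<gamma> = \<gamma> ` A \<epsilon>"
        by (simp add: shadow_def A_def)
      \<comment> \<open>Shrinking the ball enlarges its complement, so the lower bound \<delta>
        found at radius \<open>\<epsilon>\<^sub>0\<close> serves every smaller \<epsilon>.\<close>
      have "A \<epsilon>\<^sub>0 \<subseteq> A \<epsilon>"
        using \<epsilon>(2) mball_subset_concentric[of \<epsilon> \<epsilon>\<^sub>0] by (auto simp: A_def)
      then have "measure \<mu> (A \<epsilon>\<^sub>0) \<le> measure \<mu> (A \<epsilon>)"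
        using A_sets sets_\<mu> by (intro finite_measure_mono) auto
      then have A_low: "\<delta> \<le> measure \<mu> (A \<epsilon>)"
        using low[OF inv\<gamma>] by (simp add: A_def)
      have "(1 / C) * exp (- \<beta> * N \<gamma>) \<le> (\<delta> / c) * exp (- \<beta> * N \<gamma>)"
        using inv_C by (intro mult_right_mono) auto
      also have "\<dots> = exp (- C\<^sub>0 - \<bar>\<beta>\<bar> * D - \<beta> * N \<gamma>) * \<delta>"
        by (simp add: c_def exp_diff exp_minus exp_add field_simps)
      also have "\<dots> \<le> exp (- C\<^sub>0 - \<bar>\<beta>\<bar> * D - \<beta> * N \<gamma>) * measure \<mu> (A \<epsilon>)"
        using A_low by (intro mult_left_mono) auto
      also have "\<dots> \<le> measure \<mu> (shadow \<Gamma> d \<epsilon> \<gamma>)"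
        unfolding shadow by (rule bounds(1))
      finally show "(1 / C) * exp (- \<beta> * N \<gamma>) \<le> measure \<mu> (shadow \<Gamma> d \<epsilon> \<gamma>)" .
      have "measure \<mu> (shadow \<Gamma> d \<epsilon> \<gamma>) \<le> exp (C\<^sub>0 + \<bar>\<beta>\<bar> * D - \<beta> * N \<gamma>) * measure \<mu> (A \<epsilon>)"
        unfolding shadow by (rule bounds(2))
      also have "\<dots> \<le> exp (C\<^sub>0 + \<bar>\<beta>\<bar> * D - \<beta> * N \<gamma>) * 1"
        by (intro mult_left_mono) auto
      also have "\<dots> = c * exp (- \<beta> * N \<gamma>)"
        by (simp add: c_def exp_diff exp_minus field_simps)
      also have "\<dots> \<le> C * exp (- \<beta> * N \<gamma>)"
        using C(2) by (intro mult_right_mono) auto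
      finally show "measure \<mu> (shadow \<Gamma> d \<epsilon> \<gamma>) \<le> C * exp (- \<beta> * N \<gamma>)" .
    qed
  qed
qed

end
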